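(* Let $K$ be the infinite king's grid. Then $\mathrm{RED{:}IC}\%(K) \le \frac{1}{3}$, where $\mathrm{RED{:}IC}\%(K)$ denotes the lowest density of a redundant identifying code (RED:IC) on $K$.
   Context: The infinite king's grid $K$ is the infinite graph with vertex set $\mathbb{Z}^2$ in which two distinct vertices $(a,b)$ and $(c,d)$ are adjacent if and only if $\max(|a-c|,|b-d|)=1$ (so $K$ is 8-regular). $N[v]$ denotes the closed neighborhood of $v$ (the set consisting of $v$ and all vertices adjacent to $v$). A set $S \subseteq V(G)$ of vertices of a graph $G$ is an identifying code (IC) if, for every vertex $v$, $N[v]\cap S \neq \varnothing$, and for all distinct vertices $u,v$, $N[u]\cap S \ne N[v]\cap S$. A set $S$ is a redundant identifying code (RED:IC) if for every $D \subseteq S$ with $|D|\le 1$, the set $S - D$ is an IC (in particular $S$ itself is an IC). The density of $S\subseteq V(K)$ is the ratio of the size of $S$ to that of $V(K)$, understood as $\limsup_{n\to\infty} \frac{|S\cap Q_n|}{|Q_n|}$ with $Q_n=\{-n,\dots,n\}^2$. $\mathrm{RED{:}IC}\%(K)$ is the infimum of the densities of all RED:ICs on $K$. *)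

theory Defs
  imports "HOL-Library.Extended_Real"
begin

text \<open>A graph is given by a vertex set \<open>V\<close> and an adjacency relation \<open>adj\<close>, taken to be
  symmetric and irreflexive on \<open>V\<close> (see \<open>king_adj_sym\<close> and \<open>king_adj_irrefl\<close> below for the
  king's grid). Vertex sets may be infinite.\<close>

definition closed_nbhd :: "'a set \<Rightarrow> ('a \<Rightarrow> 'a \<Rightarrow> bool) \<Rightarrow> 'a \<Rightarrow> 'a set" where
  "closed_nbhd V adj v = insert v {u \<in> V. adj v u}"

definition identifying_code :: "'a set \<Rightarrow> ('a \<Rightarrow> 'a \<Rightarrow> bool) \<Rightarrow> 'a set \<Rightarrow> bool" where
  "identifying_code V adj S \<longleftrightarrow>
     S \<subseteq> V \<and>
     (\<forall>v\<in>V. closed_nbhd V adj v \<inter> S \<noteq> {}) \<and>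
     (\<forall>u\<in>V. \<forall>v\<in>V. u \<noteq> v \<longrightarrow> closed_nbhd V adj u \<inter> S \<noteq> closed_nbhd V adj v \<inter> S)"

text \<open>The explicit finiteness of \<open>D\<close> is needed because \<open>card\<close> is \<open>0\<close> on infinite sets.\<close>

definition redundant_identifying_code :: "'a set \<Rightarrow> ('a \<Rightarrow> 'a \<Rightarrow> bool) \<Rightarrow> 'a set \<Rightarrow> bool" where
  "redundant_identifying_code V adj S \<longleftrightarrow>
     S \<subseteq> V \<and>
     (\<forall>D. D \<subseteq> S \<and> finite D \<and> card D \<le> 1 \<longrightarrow> identifying_code V adj (S - D))"

definition king_vertices :: "(int \<times> int) set" where
  "king_vertices = UNIV"

definition king_adj :: "int \<times> int \<Rightarrow> int \<times> int \<Rightarrow> bool" where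
  "king_adj u v \<longleftrightarrow> max \<bar>fst u - fst v\<bar> \<bar>snd u - snd v\<bar> = 1"

lemma king_adj_sym: "king_adj u v \<longleftrightarrow> king_adj v u"
  by (simp add: king_adj_def abs_minus_commute)

lemma king_adj_irrefl: "\<not> king_adj v v"
  by (simp add: king_adj_def)

definition king_box :: "nat \<Rightarrow> (int \<times> int) set" where
  "king_box n = {- int n..int n} \<times> {- int n..int n}"

text \<open>The upper limit is taken in the complete lattice \<^typ>\<open>ereal\<close>, where it always exists.\<close>

definition king_density :: "(int \<times> int) set \<Rightarrow> ereal" where
  "king_density S = limsup (\<lambda>n. ereal (real (card (S \<inter> king_box n)) / real (card (king_box n))))"

definition king_RED_IC_density :: ereal where
  "king_RED_IC_density =
     (INF S \<in> {S. redundant_identifying_code king_vertices king_adj S}. king_density S)"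

end

(* The code consists of every third antidiagonal, {(x, y). 3 dvd x + y}. Any three consecutive
   vertices of a row or column contain exactly one codeword. If u lies strictly to the left of v,
   then the leftmost column of N[u] misses N[v] and the rightmost column of N[v] misses N[u]; each
   contains a codeword, so u and v are separated twice. Rows are treated alike. *)

theory Submission
  imports Defs "HOL-Real_Asymp.Real_Asymp"
begin

text \<open>Deleting at most one codeword cannot destroy both of two distinct witnesses. For
  separation the witnesses are sought in the two opposite set differences, which makes them distinct
  automatically.\<close>

lemma redundant_identifying_codeI:
  assumes "S \<subseteq> V"
    and dom: "\<And>v. v \<in> V \<Longrightarrow>
      \<exists>p q. p \<noteq> q \<and> p \<in> closed_nbhd V adj v \<inter> S \<and> q \<in> closed_nbhd V adj v \<inter> S"
    and sep: "\<And>u v. u \<in> V \<Longrightarrow> v \<in> V \<Longrightarrow> u \<noteq> v \<Longrightarrow>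
      \<exists>p q. p \<in> (closed_nbhd V adj u - closed_nbhd V adj v) \<inter> S \<and>
            q \<in> (closed_nbhd V adj v - closed_nbhd V adj u) \<inter> S"
  shows "redundant_identifying_code V adj S"
  unfolding redundant_identifying_code_def identifying_code_def
proof (intro conjI allI impI ballI)
  show "S \<subseteq> V" by fact
next
  fix D assume D: "D \<subseteq> S \<and> finite D \<and> card D \<le> 1"
  then have avoid: "p \<notin> D \<or> q \<notin> D" if "p \<noteq> q" for p q
    using that by (metis card_le_Suc0_iff_eq One_nat_def)
  show "S - D \<subseteq> V" using \<open>S \<subseteq> V\<close> by blast
  show "closed_nbhd V adj v \<inter> (S - D) \<noteq> {}" if "v \<in> V" for v
    using dom[OF that] avoid by blast
  show "closed_nbhd V adj u \<inter> (S - D) \<noteq> closed_nbhd V adj v \<inter> (S - D)"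
    if uv: "u \<in> V" "v \<in> V" "u \<noteq> v" for u v
  proof -
    obtain p q where p: "p \<in> (closed_nbhd V adj u - closed_nbhd V adj v) \<inter> S"
      and q: "q \<in> (closed_nbhd V adj v - closed_nbhd V adj u) \<inter> S"
      using sep[OF uv] by blast
    then have "p \<noteq> q" by blast
    with avoid p q show ?thesis by blast
  qed
qed

text \<open>Adjoining the centre relaxes maximum distance equal to 1 to at most 1, so the closed
  neighborhood is a 3 by 3 block and each coordinate can be tested separately.\<close>

lemma king_nbhd_iff:
  "(c, d) \<in> closed_nbhd king_vertices king_adj (a, b) \<longleftrightarrow> \<bar>c - a\<bar> \<le> 1 \<and> \<bar>d - b\<bar> \<le> 1"
  by (auto simp: closed_nbhd_def king_vertices_def king_adj_def max_def)

definition antidiagonal_code :: "(int \<times> int) set" where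
  "antidiagonal_code = {(x, y). 3 dvd x + y}"

text \<open>As \<open>d\<close> runs through \<open>b - 1\<close>, \<open>b\<close>,
  \<open>b + 1\<close>, the sum \<open>c + d\<close> meets every residue modulo 3.\<close>

lemma antidiagonal_code_column:
  obtains d where "\<bar>d - b\<bar> \<le> 1" "(c, d) \<in> antidiagonal_code"
proof -
  have "\<exists>d. \<bar>d - b\<bar> \<le> 1 \<and> 3 dvd c + d" by presburger
  then show ?thesis using that by (auto simp: antidiagonal_code_def)
qed

lemma antidiagonal_code_row:
  obtains c where "\<bar>c - a\<bar> \<le> 1" "(c, d) \<in> antidiagonal_code"
proof -
  have "\<exists>c. \<bar>c - a\<bar> \<le> 1 \<and> 3 dvd c + d" by presburger
  then show ?thesis using that by (auto simp: antidiagonal_code_def)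
qed

lemma antidiagonal_code_redundant:
  "redundant_identifying_code king_vertices king_adj antidiagonal_code"
proof (rule redundant_identifying_codeI)
  show "antidiagonal_code \<subseteq> king_vertices" by (simp add: king_vertices_def)
next
  fix v :: "int \<times> int"
  obtain a b where v: "v = (a, b)" by (cases v)
  \<comment> \<open>The outer columns of the block around \<open>v\<close> are disjoint, so their
    codewords differ.\<close>
  obtain d where d: "\<bar>d - b\<bar> \<le> 1" "(a - 1, d) \<in> antidiagonal_code"
    by (rule antidiagonal_code_column)
  obtain e where e: "\<bar>e - b\<bar> \<le> 1" "(a + 1, e) \<in> antidiagonal_code"
    by (rule antidiagonal_code_column)
  show "\<exists>p q. p \<noteq> q \<and> p \<in> closed_nbhd king_vertices king_adj v \<inter> antidiagonal_code \<and>
      q \<in> closed_nbhd king_vertices king_adj v \<inter> antidiagonal_code"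
    using d e unfolding v
    by (intro exI[of _ "(a - 1, d)"] exI[of _ "(a + 1, e)"]) (auto simp: king_nbhd_iff)
next
  let ?N = "closed_nbhd king_vertices king_adj" and ?S = antidiagonal_code
  let ?sep = "\<lambda>u v. \<exists>p q. p \<in> (?N u - ?N v) \<inter> ?S \<and> q \<in> (?N v - ?N u) \<inter> ?S"
  have horizontal: "?sep (a, b) (a', b')" if "a < a'" for a b a' b'
  proof -
    \<comment> \<open>First coordinates alone decide: \<open>a - 1\<close> is at distance at least 2
      from \<open>a'\<close>, and \<open>a' + 1\<close> from \<open>a\<close>.\<close>
    obtain d where d: "\<bar>d - b\<bar> \<le> 1" "(a - 1, d) \<in> ?S"
      by (rule antidiagonal_code_column)
    obtain e where e: "\<bar>e - b'\<bar> \<le> 1" "(a' + 1, e) \<in> ?S"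
      by (rule antidiagonal_code_column)
    show ?thesis using that d e
      by (intro exI[of _ "(a - 1, d)"] exI[of _ "(a' + 1, e)"]) (auto simp: king_nbhd_iff)
  qed
  have vertical: "?sep (a, b) (a', b')" if "b < b'" for a b a' b'
  proof -
    obtain c where c: "\<bar>c - a\<bar> \<le> 1" "(c, b - 1) \<in> ?S"
      by (rule antidiagonal_code_row)
    obtain e where e: "\<bar>e - a'\<bar> \<le> 1" "(e, b' + 1) \<in> ?S"
      by (rule antidiagonal_code_row)
    show ?thesis using that c e
      by (intro exI[of _ "(c, b - 1)"] exI[of _ "(e, b' + 1)"]) (auto simp: king_nbhd_iff)
  qed
  fix u v :: "int \<times> int" assume "u \<noteq> v"
  obtain a b a' b' where uv: "u = (a, b)" "v = (a', b')" by (metis surj_pair)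
  with \<open>u \<noteq> v\<close> consider "a < a'" | "a' < a" | "b < b'" | "b' < b" by fastforce
  \<comment> \<open>\<open>?sep\<close> is symmetric, by exchanging \<open>p\<close> and
    \<open>q\<close>, so the reversed inequalities follow as well.\<close>
  then show "?sep u v"
    unfolding uv using horizontal vertical by cases blast+
qed

lemma card_antidiagonal_code_box:
  "3 * card (antidiagonal_code \<inter> king_box n) \<le> (2 * n + 3) * (2 * n + 1)"
proof -
  \<comment> \<open>The translates of the code by 0, 1 and 2 in the first coordinate are disjoint.\<close>
  let ?f = "\<lambda>((x, y), i). (x + i, y) :: int \<times> int"
  \<comment> \<open>Translating by up to 2 adds two columns on the right, hence the factor
    \<open>2 * n + 3\<close>.\<close>
  let ?B = "{- int n..int n + 2} \<times> {- int n..int n}"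
  have "inj_on ?f ((antidiagonal_code \<inter> king_box n) \<times> {0..2})"
  proof (rule inj_onI, clarsimp simp: antidiagonal_code_def)
    fix x y i x' i' :: int
    assume "3 dvd x + y" "3 dvd x' + y" "0 \<le> i" "i \<le> 2" "0 \<le> i'" "i' \<le> 2" "x + i = x' + i'"
    \<comment> \<open>Here \<open>x - x' = i' - i\<close> is a multiple of 3 of absolute value at
      most 2, hence 0.\<close>
    then show "x = x' \<and> i = i'" by presburger
  qed
  moreover have "?f ` ((antidiagonal_code \<inter> king_box n) \<times> {0..2}) \<subseteq> ?B"
    by (auto simp: king_box_def)
  ultimately have "card ((antidiagonal_code \<inter> king_box n) \<times> {0..2::int}) \<le> card ?B"
    by (intro card_inj_on_le) auto
  moreover have "card ?B = (2 * n + 3) * (2 * n + 1)"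
    by (simp add: card_cartesian_product nat_add_distrib nat_mult_distrib)
  ultimately show ?thesis
    by (simp add: card_cartesian_product)
qed

lemma king_density_antidiagonal_code: "king_density antidiagonal_code \<le> ereal (1 / 3)"
proof -
  have bound: "real (card (antidiagonal_code \<inter> king_box n)) / real (card (king_box n))
      \<le> (2 * real n + 3) / (3 * (2 * real n + 1))" for n
  proof -
    \<comment> \<open>The side length of the box; one factor \<open>m\<close> cancels against the
      count.\<close>
    define m where "m = 2 * real n + 1"
    have "m > 0" by (simp add: m_def)
    have box: "real (card (king_box n)) = m * m"
      by (simp add: king_box_def card_cartesian_product m_def)
    have "real (3 * card (antidiagonal_code \<inter> king_box n)) \<le> real ((2 * n + 3) * (2 * n + 1))"
      using card_antidiagonal_code_box by (intro of_nat_mono)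
    then have "real (card (antidiagonal_code \<inter> king_box n)) \<le> (2 * real n + 3) * m / 3"
      by (simp add: m_def algebra_simps)
    then have "real (card (antidiagonal_code \<inter> king_box n)) / (m * m)
        \<le> ((2 * real n + 3) * m / 3) / (m * m)"
      using \<open>m > 0\<close> by (intro divide_right_mono) auto
    also have "\<dots> = (2 * real n + 3) / (3 * m)"
      using \<open>m > 0\<close> by simp
    finally show ?thesis by (simp only: box m_def)
  qed
  have "king_density antidiagonal_code
      \<le> limsup (\<lambda>n. ereal ((2 * real n + 3) / (3 * (2 * real n + 1))))"
    unfolding king_density_def using bound by (intro Limsup_mono always_eventually) auto
  also have "\<dots> = ereal (1 / 3)"
  \<comment> \<open>The bounding sequence converges, so its upper limit is its limit; the two extra
    columns vanish asymptotically.\<close>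
  proof (intro lim_imp_Limsup tendsto_ereal)
    show "(\<lambda>n. (2 * real n + 3) / (3 * (2 * real n + 1))) \<longlonglongrightarrow> 1 / 3" by real_asymp
  qed simp
  finally show ?thesis .
qed

theorem mainTheorem4:
  shows "king_RED_IC_density \<le> ereal (1 / 3)"
  unfolding king_RED_IC_density_def
  using antidiagonal_code_redundant king_density_antidiagonal_code
  by (intro INF_lower2[of antidiagonal_code]) auto

end
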